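(* Let $E$ be the dual of a Banach space $E_{\ast}$, let $C$ be a nonempty weak$^{\ast}$ compact convex subset of $E$, and let $\mathcal{S}$ be an arbitrary family of pairwise commuting mappings $T: C \to C$, each of which is weak$^{\ast}$ continuous and nonexpansive. Then the set of common fixed points $\operatorname{Fix}\mathcal{S} = \bigcap_{T \in \mathcal{S}} \operatorname{Fix} T$ is a (nonempty) nonexpansive retract of $C$.
   Context: The weak$^{\ast}$ topology on $E = (E_{\ast})^{\ast}$ is the one induced by the predual $E_{\ast}$; weak$^{\ast}$ continuity of $T: C \to C$ means continuity when $C$ carries the weak$^{\ast}$ topology on both sides. A mapping $T: C \to C$ is nonexpansive if $\|Tx - Ty\| \le \|x - y\|$ for all $x, y \in C$, where $\|\cdot\|$ is the (dual) norm of $E$. $\operatorname{Fix} T = \{x \in C : Tx = x\}$. The mappings are not assumed to be linear or affine. A nonempty set $D \subset C$ is a nonexpansive retract of $C$ if there exists a nonexpansive mapping $R: C \to D$ (i.e. $\|Rx - Ry\| \le \|x-y\|$ for all $x,y \in C$) such that $Rx = x$ for all $x \in D$. *)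

theory Defs
  imports "HOL-Analysis.Analysis"
begin

text \<open>
  The dual of a real Banach space \<open>'a\<close> is the type \<open>'a \<Rightarrow>\<^sub>L real\<close> of bounded linear functionals
  with the operator norm.  The topology of its type class is the norm topology; the weak-star
  topology is the one of pointwise convergence on \<open>'a\<close>, that is, the library's strong operator
  topology in the case of scalar-valued operators.
\<close>

definition weak_star_topology :: "('a::real_normed_vector \<Rightarrow>\<^sub>L real) topology" where
  "weak_star_topology = strong_operator_topology"

text \<open>
  A mapping between subsets of a space is represented by a total function together with a
  condition \<open>T \<in> C \<rightarrow> D\<close>; its values outside \<open>C\<close> are irrelevant.
\<close>

definition weak_star_continuous_on ::
  "('a::real_normed_vector \<Rightarrow>\<^sub>L real) set \<Rightarrow> (('a \<Rightarrow>\<^sub>L real) \<Rightarrow> ('a \<Rightarrow>\<^sub>L real)) \<Rightarrow> bool" where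
  "weak_star_continuous_on C T \<longleftrightarrow>
     continuous_map (subtopology weak_star_topology C) (subtopology weak_star_topology C) T"

definition nonexpansive_on :: "'b::real_normed_vector set \<Rightarrow> ('b \<Rightarrow> 'b) \<Rightarrow> bool" where
  "nonexpansive_on C T \<longleftrightarrow> (\<forall>x\<in>C. \<forall>y\<in>C. norm (T x - T y) \<le> norm (x - y))"

definition Fix :: "'b set \<Rightarrow> ('b \<Rightarrow> 'b) \<Rightarrow> 'b set" where
  "Fix C T = {x \<in> C. T x = x}"

text \<open>The intersection is taken inside \<open>C\<close>, so that the empty family has fixed point set \<open>C\<close>.\<close>

definition common_Fix :: "'b set \<Rightarrow> ('b \<Rightarrow> 'b) set \<Rightarrow> 'b set" where
  "common_Fix C \<S> = C \<inter> (\<Inter>T\<in>\<S>. Fix C T)"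

definition nonexpansive_retract :: "'b::real_normed_vector set \<Rightarrow> 'b set \<Rightarrow> bool" where
  "nonexpansive_retract D C \<longleftrightarrow>
     D \<noteq> {} \<and> D \<subseteq> C \<and> (\<exists>R. R \<in> C \<rightarrow> D \<and> nonexpansive_on C R \<and> (\<forall>x\<in>D. R x = x))"

end

theory Submission
  imports Defs
begin

text \<open>
  The idea is to look for the retraction itself, rather than for fixed points, by a compactness
  argument in the space of all mappings \<open>C \<rightarrow> C\<close>.  With pointwise weak-star convergence this space
  is compact by Tychonoff's theorem.  Since the dual norm is weak-star lower semicontinuous, each of
  the conditions ``\<open>R\<close> is nonexpansive'', ``\<open>R\<close> fixes every common fixed point'' and
  ``\<open>\<parallel>T (R x) - R x\<parallel> \<le> e\<close> for all \<open>x\<close>'' is closed in it; for the last one weak-star continuity of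
  \<open>T\<close> is needed.  By the finite intersection property, a retraction onto the common fixed points
  exists as soon as there are approximate ones, for each \<open>e > 0\<close> and each finite subfamily
  (\<open>retraction_from_approximate_retractions\<close>).

  For a finite family one adds one mapping at a time.  Let \<open>R\<close> be a nonexpansive retraction onto the
  common fixed point set \<open>D\<close> of the mappings treated so far, and let \<open>T\<close> be the next one.  It maps
  \<open>D\<close> into \<open>D\<close> because the mappings commute.  For \<open>x \<in> C\<close> and \<open>0 < t < 1\<close> the contraction
  \<open>z \<mapsto> t x + (1 - t) T (R z)\<close> of \<open>C\<close> has a fixed point \<open>P x\<close>, and \<open>P x\<close> differs from \<open>T (R (P x))\<close> by at
  most \<open>t\<close> times the diameter of \<open>C\<close>.  Applying \<open>R\<close> to both, which leaves \<open>T (R (P x)) \<in> D\<close> alone,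
  shows that \<open>T\<close> moves the values of \<open>R \<circ> P : C \<rightarrow> D\<close> by just as little
  (\<open>approximate_retraction_step\<close>).  So \<open>R \<circ> P\<close> is an approximate retraction for the enlarged family,
  although \<open>R\<close> need not be weak-star continuous, and compactness makes it exact.

  An arbitrary family is then handled by compactness once more, the exact retractions
  for the finite subfamilies serving as approximate ones.
\<close>

section \<open>The weak-star topology\<close>

lemma topspace_weak_star [simp]: "topspace weak_star_topology = UNIV"
  by (simp add: weak_star_topology_def strong_operator_topology_topspace)

lemma continuous_map_weak_star_iff:
  "continuous_map X weak_star_topology f \<longleftrightarrow>
     (\<forall>a. continuous_map X euclideanreal (\<lambda>z. blinfun_apply (f z) a))"
  by (simp add: weak_star_topology_def continuous_on_strong_operator_topo_iff_coordinatewise)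

lemma continuous_map_weak_star_eval:
  "continuous_map weak_star_topology euclideanreal (\<lambda>\<phi>. blinfun_apply \<phi> a)"
  by (simp add: weak_star_topology_def strong_operator_topology_continuous_evaluation)

lemma Hausdorff_space_weak_star: "Hausdorff_space weak_star_topology"
proof (rule Hausdorff_space_injective_preimage)
  show "Hausdorff_space (euclidean :: ('a \<Rightarrow> real) topology)"
    unfolding euclidean_product_topology[symmetric] Hausdorff_space_product_topology by simp
  show "continuous_map weak_star_topology euclidean
          (blinfun_apply :: ('a \<Rightarrow>\<^sub>L real) \<Rightarrow> 'a \<Rightarrow> real)"
    using continuous_map_pullback[of euclidean euclidean "\<lambda>f. f" UNIV blinfun_apply]
    by (simp add: weak_star_topology_def strong_operator_topology_def o_def)
  show "inj_on blinfun_apply (topspace (weak_star_topology :: ('a \<Rightarrow>\<^sub>L real) topology))"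
    by (simp add: inj_on_def blinfun_apply_inject)
qed

lemma closedin_Collect_Ball:
  assumes "\<And>i. i \<in> I \<Longrightarrow> closedin X {z \<in> topspace X. P i z}"
  shows "closedin X {z \<in> topspace X. \<forall>i\<in>I. P i z}"
proof -
  have "{z \<in> topspace X. \<forall>i\<in>I. P i z}
        = \<Inter>(insert (topspace X) ((\<lambda>i. {z \<in> topspace X. P i z}) ` I))"
    by auto
  then show ?thesis
    using assms by (simp only:) (rule closedin_Inter, auto)
qed

text \<open>
  Weak-star lower semicontinuity of the dual norm: \<open>\<parallel>\<phi>\<parallel> \<le> r\<close> is the conjunction of the weak-star
  closed conditions \<open>\<bar>\<phi> a\<bar> \<le> r \<parallel>a\<parallel>\<close>.
\<close>

lemma closedin_norm_diff_le:
  fixes f g :: "'z \<Rightarrow> ('a::real_normed_vector \<Rightarrow>\<^sub>L real)"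
  assumes f: "continuous_map X weak_star_topology f"
    and g: "continuous_map X weak_star_topology g"
    and r: "0 \<le> r"
  shows "closedin X {z \<in> topspace X. norm (f z - g z) \<le> r}"
proof -
  have norm_iff: "norm (f z - g z) \<le> r \<longleftrightarrow>
      (\<forall>a\<in>UNIV. \<bar>blinfun_apply (f z) a - blinfun_apply (g z) a\<bar> \<le> r * norm a)" for z
  proof
    assume *: "norm (f z - g z) \<le> r"
    show "\<forall>a\<in>UNIV. \<bar>blinfun_apply (f z) a - blinfun_apply (g z) a\<bar> \<le> r * norm a"
    proof
      fix a
      have "\<bar>blinfun_apply (f z) a - blinfun_apply (g z) a\<bar> \<le> norm (f z - g z) * norm a"
        using norm_blinfun[of "f z - g z" a] by (simp add: blinfun.diff_left)
      also have "\<dots> \<le> r * norm a"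
        using * by (simp add: mult_right_mono)
      finally show "\<bar>blinfun_apply (f z) a - blinfun_apply (g z) a\<bar> \<le> r * norm a" .
    qed
  next
    assume "\<forall>a\<in>UNIV. \<bar>blinfun_apply (f z) a - blinfun_apply (g z) a\<bar> \<le> r * norm a"
    then show "norm (f z - g z) \<le> r"
      using r by (intro norm_blinfun_bound) (auto simp: blinfun.diff_left)
  qed
  have "closedin X {z \<in> topspace X.
      \<bar>blinfun_apply (f z) a - blinfun_apply (g z) a\<bar> \<in> {..r * norm a}}" for a
    using f g unfolding continuous_map_weak_star_iff
    by (intro closedin_continuous_map_preimage[where Y = euclideanreal]
        continuous_map_real_abs continuous_map_diff) auto
  then show ?thesis
    unfolding norm_iff by (intro closedin_Collect_Ball) simp
qed

lemma weak_star_compact_imp_complete: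
  fixes C :: "('a::real_normed_vector \<Rightarrow>\<^sub>L real) set"
  assumes "compactin weak_star_topology C"
  shows "complete C"
proof -
  have "closedin weak_star_topology C"
    using assms Hausdorff_space_weak_star compactin_imp_closedin by blast
  moreover have "continuous_map euclidean weak_star_topology (\<lambda>\<phi> :: 'a \<Rightarrow>\<^sub>L real. \<phi>)"
    by (simp add: weak_star_topology_def strong_operator_topology_weaker_than_euclidean)
  ultimately have "closedin euclidean {\<phi> \<in> topspace euclidean. \<phi> \<in> C}"
    by (rule closedin_continuous_map_preimage[rotated])
  then show ?thesis
    by (simp add: complete_eq_closed)
qed

text \<open>
  This is the uniform boundedness principle, and the only place where completeness of the predual
  is used.  By Baire's theorem one of the closed sets \<open>{a. \<forall>\<phi>\<in>C. \<bar>\<phi> a\<bar> \<le> n}\<close> contains a ball, and the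
  bound transfers from that ball to the ball around \<open>0\<close> by taking differences.
\<close>

lemma weak_star_compact_imp_bounded:
  fixes C :: "('a::banach \<Rightarrow>\<^sub>L real) set"
  assumes C: "compactin weak_star_topology C"
  shows "bounded C"
proof -
  define A where "A n = {a. \<forall>\<phi>\<in>C. \<bar>blinfun_apply \<phi> a\<bar> \<le> real n}" for n
  have closed_A: "closed (A n)" for n
  proof -
    have "A n = (\<Inter>\<phi>\<in>C. {a. \<bar>blinfun_apply \<phi> a\<bar> \<le> real n})"
      by (auto simp: A_def)
    then show ?thesis
      by (auto intro!: closed_INT closed_Collect_le continuous_intros)
  qed
  have cover: "\<Union>(range A) = UNIV"
  proof -
    have "\<exists>n. a \<in> A n" for a
    proof -
      have "compactin euclideanreal ((\<lambda>\<phi>. blinfun_apply \<phi> a) ` C)"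
        using C continuous_map_weak_star_eval by (rule image_compactin)
      then have "bounded ((\<lambda>\<phi>. blinfun_apply \<phi> a) ` C)"
        by (simp add: compact_imp_bounded)
      then obtain B where B: "\<forall>\<phi>\<in>C. \<bar>blinfun_apply \<phi> a\<bar> \<le> B"
        by (auto simp: bounded_iff)
      obtain n where "B \<le> real n"
        using real_arch_simple by blast
      with B have "a \<in> A n"
        by (auto simp: A_def intro: order_trans)
      then show ?thesis ..
    qed
    then show ?thesis by blast
  qed
  have "\<exists>n. interior (A n) \<noteq> {}"
  proof (rule ccontr)
    assume "\<not> ?thesis"
    then have "euclidean interior_of \<Union>(range A) = {}"
      using closed_A
      by (intro Baire_category_alt disjI1 completely_metrizable_space_euclidean) auto
    then show False
      by (simp add: cover)
  qed
  then obtain n a where "a \<in> interior (A n)"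
    by blast
  then obtain d where d: "d > 0" "cball a d \<subseteq> A n"
    unfolding mem_interior_cball by blast
  have "norm \<phi> \<le> 2 * real n / d" if \<phi>: "\<phi> \<in> C" for \<phi>
  proof (rule norm_blinfun_bound)
    show "0 \<le> 2 * real n / d"
      using d by simp
    fix b :: 'a
    show "norm (blinfun_apply \<phi> b) \<le> 2 * real n / d * norm b"
    proof (cases "b = 0")
      case False
      define c where "c = (d / norm b) *\<^sub>R b"
      have "norm c = d"
        using False d by (simp add: c_def)
      then have "a + c \<in> A n" "a \<in> A n"
        using d by (auto simp: dist_norm)
      then have "\<bar>blinfun_apply \<phi> (a + c)\<bar> \<le> real n" "\<bar>blinfun_apply \<phi> a\<bar> \<le> real n"
        using \<phi> by (auto simp: A_def)
      then have "\<bar>blinfun_apply \<phi> c\<bar> \<le> 2 * real n"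
        by (simp add: blinfun.add_right)
      then have "d / norm b * \<bar>blinfun_apply \<phi> b\<bar> \<le> 2 * real n"
        using d by (simp add: c_def blinfun.scaleR_right abs_mult)
      then show ?thesis
        using False d by (simp add: field_simps)
    qed simp
  qed
  then show ?thesis
    unfolding bounded_iff by blast
qed

section \<open>Approximate retractions\<close>

lemma mem_common_Fix: "x \<in> common_Fix C \<S> \<longleftrightarrow> x \<in> C \<and> (\<forall>T\<in>\<S>. T x = x)"
  by (auto simp: common_Fix_def Fix_def)

text \<open>
  Approximating \<open>T \<circ> R\<close> by contractions yields, for each \<open>x\<close>, a point that \<open>T \<circ> R\<close> almost fixes.
  Such a point need not lie in \<open>D\<close>, but its image under \<open>R\<close> does.
\<close>

lemma approximate_retraction_step:
  fixes C D :: "'b::real_normed_vector set"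
  assumes C: "complete C" "convex C" "bounded C"
    and D: "D \<subseteq> C"
    and R: "R \<in> C \<rightarrow> D" "nonexpansive_on C R" "\<And>x. x \<in> D \<Longrightarrow> R x = x"
    and T: "T \<in> D \<rightarrow> D" "nonexpansive_on C T"
    and e: "0 < e"
  obtains Q where "Q \<in> C \<rightarrow> D" "nonexpansive_on C Q"
    "\<And>x. x \<in> D \<Longrightarrow> T x = x \<Longrightarrow> Q x = x"
    "\<And>x. x \<in> C \<Longrightarrow> norm (T (Q x) - Q x) \<le> e"
proof -
  obtain M where M: "M > 0" "\<And>x y. x \<in> C \<Longrightarrow> y \<in> C \<Longrightarrow> norm (x - y) \<le> M"
  proof -
    obtain B where B: "B > 0" "\<And>x. x \<in> C \<Longrightarrow> norm x \<le> B"
      using C(3) by (auto simp: bounded_pos)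
    have "norm (x - y) \<le> B + B" if "x \<in> C" "y \<in> C" for x y
      using norm_triangle_ineq4[of x y] B(2)[OF that(1)] B(2)[OF that(2)] by linarith
    with B(1) show ?thesis
      by (intro that[of "B + B"]) auto
  qed
  \<comment> \<open>The distance from \<open>P x\<close> to \<open>T (R (P x))\<close> will be at most \<open>t * M\<close>, so \<open>t * M \<le> e\<close> is needed.\<close>
  define t where "t = e / (e + M)"
  have t: "0 < t" "t < 1" "t * M \<le> e"
    using e M(1) by (auto simp: t_def field_simps)
  have TR: "T (R z) \<in> D" "T (R z) \<in> C" if "z \<in> C" for z
    using that R(1) T(1) D by (auto simp: Pi_iff subset_iff)
  have TR_nonexp: "norm (T (R z) - T (R w)) \<le> norm (z - w)" if "z \<in> C" "w \<in> C" for z w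
  proof -
    have "R z \<in> C" "R w \<in> C"
      using that R(1) D by (auto simp: Pi_iff subset_iff)
    then have "norm (T (R z) - T (R w)) \<le> norm (R z - R w)"
      using T(2) by (auto simp: nonexpansive_on_def)
    also have "\<dots> \<le> norm (z - w)"
      using that R(2) by (auto simp: nonexpansive_on_def)
    finally show ?thesis .
  qed
  have ex: "\<exists>!z. z \<in> C \<and> t *\<^sub>R x + (1 - t) *\<^sub>R T (R z) = z" if x: "x \<in> C" for x
  proof (rule Banach_fix[where c = "1 - t"])
    show "(\<lambda>z. t *\<^sub>R x + (1 - t) *\<^sub>R T (R z)) ` C \<subseteq> C"
      using x t TR(2) convexD[OF C(2), of x _ t "1 - t"] by auto
    fix z w
    assume zw: "z \<in> C" "w \<in> C"
    have "dist (t *\<^sub>R x + (1 - t) *\<^sub>R T (R z)) (t *\<^sub>R x + (1 - t) *\<^sub>R T (R w))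
          = norm ((1 - t) *\<^sub>R (T (R z) - T (R w)))"
      by (simp add: dist_norm algebra_simps)
    also have "\<dots> = (1 - t) * norm (T (R z) - T (R w))"
      using t by simp
    also have "\<dots> \<le> (1 - t) * dist z w"
      using TR_nonexp[OF zw] t by (simp add: dist_norm mult_left_mono)
    finally show "dist (t *\<^sub>R x + (1 - t) *\<^sub>R T (R z)) (t *\<^sub>R x + (1 - t) *\<^sub>R T (R w))
          \<le> (1 - t) * dist z w" .
  qed (use C x t in auto)
  define P where "P x = (THE z. z \<in> C \<and> t *\<^sub>R x + (1 - t) *\<^sub>R T (R z) = z)" for x
  have P: "P x \<in> C" "t *\<^sub>R x + (1 - t) *\<^sub>R T (R (P x)) = P x" if "x \<in> C" for x
    using theI'[OF ex[OF that]] by (auto simp: P_def)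
  have P_nonexp: "norm (P x - P y) \<le> norm (x - y)" if xy: "x \<in> C" "y \<in> C" for x y
  proof -
    have "P x - P y = t *\<^sub>R (x - y) + (1 - t) *\<^sub>R (T (R (P x)) - T (R (P y)))"
      by (subst (1 2) P(2)[symmetric]) (auto simp: xy algebra_simps)
    then have "norm (P x - P y) \<le> t * norm (x - y) + (1 - t) * norm (T (R (P x)) - T (R (P y)))"
      using norm_triangle_ineq[of "t *\<^sub>R (x - y)" "(1 - t) *\<^sub>R (T (R (P x)) - T (R (P y)))"] t
      by simp
    also have "\<dots> \<le> t * norm (x - y) + (1 - t) * norm (P x - P y)"
      using TR_nonexp[of "P x" "P y"] P(1) xy t by (simp add: mult_left_mono)
    finally have "t * norm (P x - P y) \<le> t * norm (x - y)"
      by (simp add: algebra_simps)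
    with t show ?thesis by simp
  qed
  show ?thesis
  proof (rule that[of "R \<circ> P"])
    show "R \<circ> P \<in> C \<rightarrow> D"
      using R(1) P(1) by auto
    show "nonexpansive_on C (R \<circ> P)"
      unfolding nonexpansive_on_def
    proof (intro ballI)
      fix x y
      assume xy: "x \<in> C" "y \<in> C"
      then have "norm ((R \<circ> P) x - (R \<circ> P) y) \<le> norm (P x - P y)"
        using R(2) P(1) by (auto simp: nonexpansive_on_def)
      also have "\<dots> \<le> norm (x - y)"
        using xy by (rule P_nonexp)
      finally show "norm ((R \<circ> P) x - (R \<circ> P) y) \<le> norm (x - y)" .
    qed
    show "(R \<circ> P) x = x" if "x \<in> D" "T x = x" for x
    proof -
      have x: "x \<in> C" "R x = x"
        using that R(3) D by auto
      have "t *\<^sub>R x + (1 - t) *\<^sub>R T (R x) = x"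
        using x that by (simp add: algebra_simps)
      then have "P x = x"
        using ex[OF x(1)] P[OF x(1)] x(1) by blast
      then show ?thesis
        using x by simp
    qed
    show "norm (T ((R \<circ> P) x) - (R \<circ> P) x) \<le> e" if x: "x \<in> C" for x
    proof -
      have "norm (T (R (P x)) - R (P x)) = norm (R (T (R (P x))) - R (P x))"
        using R(3) TR(1) P(1) x by simp
      also have "\<dots> \<le> norm (T (R (P x)) - P x)"
        using R(2) TR(2) P(1) x by (auto simp: nonexpansive_on_def)
      also have "T (R (P x)) - P x = t *\<^sub>R (T (R (P x)) - x)"
        by (subst (2) P(2)[symmetric]) (auto simp: x algebra_simps)
      also have "norm \<dots> \<le> t * M"
        using M(2)[OF TR(2) x, of "P x"] P(1) x t by simp
      finally show ?thesis
        using t by simp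
    qed
  qed
qed

section \<open>From approximate to exact retractions\<close>

text \<open>
  Only retractions for finitely many \<open>T\<close> and one \<open>e\<close> at a time are assumed, but all of them fix the
  common fixed points of the whole family; this is what makes the limit a retraction.
\<close>

lemma retraction_from_approximate_retractions:
  fixes C :: "('a::real_normed_vector \<Rightarrow>\<^sub>L real) set"
  assumes C: "compactin weak_star_topology C"
    and cont: "\<And>T. T \<in> \<S> \<Longrightarrow> weak_star_continuous_on C T"
    and approx: "\<And>\<F> e. finite \<F> \<Longrightarrow> \<F> \<subseteq> \<S> \<Longrightarrow> 0 < e \<Longrightarrow>
      \<exists>R \<in> C \<rightarrow> C. nonexpansive_on C R \<and> (\<forall>x\<in>common_Fix C \<S>. R x = x) \<and>
        (\<forall>T\<in>\<F>. \<forall>x\<in>C. norm (T (R x) - R x) \<le> e)"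
  shows "\<exists>R \<in> C \<rightarrow> common_Fix C \<S>. nonexpansive_on C R \<and> (\<forall>x\<in>common_Fix C \<S>. R x = x)"
proof -
  define X where "X = product_topology (\<lambda>_. subtopology weak_star_topology C) C"
  have top_X: "topspace X = C \<rightarrow>\<^sub>E C"
    by (simp add: X_def)
  have "compact_space X"
    using C by (simp add: X_def compact_space_product_topology compact_space_subtopology)
  have proj: "continuous_map X (subtopology weak_star_topology C) (\<lambda>R. R x)" if "x \<in> C" for x
    using continuous_map_product_projection[OF that, of "\<lambda>_. subtopology weak_star_topology C"]
    by (simp add: X_def)
  \<comment> \<open>Each condition on \<open>R\<close> below is a conjunction of conditions \<open>norm (f R - g R) \<le> r\<close> with weak-star
    continuous \<open>f\<close> and \<open>g\<close>, hence closed.\<close>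
  note proj' = continuous_map_into_fulltopology[OF proj]
  define N where "N = {R \<in> topspace X. (\<forall>x\<in>C. \<forall>y\<in>C. norm (R x - R y) \<le> norm (x - y))}
      \<inter> {R \<in> topspace X. \<forall>x\<in>common_Fix C \<S>. norm (R x - x) \<le> 0}"
  have "closedin X N"
    unfolding N_def
    by (intro closedin_Int closedin_Collect_Ball closedin_norm_diff_le proj')
      (auto simp: mem_common_Fix)
  then have "compactin X N"
    using \<open>compact_space X\<close> closedin_compact_space by blast
  define B where "B = (\<lambda>(T, e). {R \<in> topspace X. \<forall>x\<in>C. norm (T (R x) - R x) \<le> e})"
  have closed_B: "closedin X (B (T, e))" if "T \<in> \<S>" "0 < e" for T e
  proof -
    have "continuous_map X weak_star_topology (\<lambda>R. T (R x))" if "x \<in> C" for x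
      using continuous_map_compose[OF proj[OF that], of _ T] cont[OF \<open>T \<in> \<S>\<close>]
      by (auto simp: weak_star_continuous_on_def o_def intro: continuous_map_into_fulltopology)
    then show ?thesis
      using that unfolding B_def prod.case
      by (intro closedin_Collect_Ball closedin_norm_diff_le proj') auto
  qed
  have fip: "N \<inter> \<Inter>\<V> \<noteq> {}" if \<V>: "finite \<V>" "\<V> \<subseteq> B ` (\<S> \<times> {0<..})" for \<V>
  proof -
    obtain I where I: "finite I" "I \<subseteq> \<S> \<times> {0<..}" "\<V> = B ` I"
      using \<V> finite_subset_image by meson
    define e where "e = Min (insert 1 (snd ` I))"
    have e: "0 < e" "\<And>p. p \<in> I \<Longrightarrow> e \<le> snd p"
      using I by (auto simp: e_def)
    have "finite (fst ` I)" "fst ` I \<subseteq> \<S>"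
      using I(1,2) by auto
    from approx[OF this e(1)] obtain R where R: "R \<in> C \<rightarrow> C" "nonexpansive_on C R"
      "\<forall>x\<in>common_Fix C \<S>. R x = x"
      "\<forall>T\<in>fst ` I. \<forall>x\<in>C. norm (T (R x) - R x) \<le> e"
      by (elim bexE conjE)
    have "restrict R C \<in> N"
      using R(1-3) by (auto simp: N_def top_X nonexpansive_on_def mem_common_Fix)
    moreover have "restrict R C \<in> B p" if "p \<in> I" for p
    proof -
      have "norm (fst p (R x) - R x) \<le> snd p" if "x \<in> C" for x
        using R(4)[rule_format, OF imageI[OF \<open>p \<in> I\<close>] that] e(2)[OF \<open>p \<in> I\<close>] by simp
      then show ?thesis
        using R(1) by (auto simp: B_def top_X case_prod_beta)
    qed
    ultimately show ?thesis
      using I(3) by blast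
  qed
  have "N \<inter> \<Inter>(B ` (\<S> \<times> {0<..})) \<noteq> {}"
    using \<open>compactin X N\<close>[unfolded compactin_fip] fip closed_B by auto
  then obtain R where R: "R \<in> N" "\<And>T e. T \<in> \<S> \<Longrightarrow> 0 < e \<Longrightarrow> R \<in> B (T, e)"
    by auto
  have R_in: "R x \<in> C" if "x \<in> C" for x
    using R(1) that by (auto simp: N_def top_X)
  have fixed: "T (R x) = R x" if "T \<in> \<S>" "x \<in> C" for T x
  proof -
    have "norm (T (R x) - R x) \<le> 0 + e" if "0 < e" for e
      using R(2)[OF \<open>T \<in> \<S>\<close> that] \<open>x \<in> C\<close> by (simp add: B_def)
    then have "norm (T (R x) - R x) \<le> 0"
      by (rule field_le_epsilon)
    then show ?thesis by simp
  qed
  show ?thesis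
  proof (intro bexI conjI)
    show "R \<in> C \<rightarrow> common_Fix C \<S>"
      using R_in fixed by (auto simp: mem_common_Fix)
    show "nonexpansive_on C R" "\<forall>x\<in>common_Fix C \<S>. R x = x"
      using R(1) by (auto simp: N_def nonexpansive_on_def)
  qed
qed

section \<open>Common fixed points\<close>

text \<open>
  The inductive step produces a retraction that is exact for \<open>\<F>\<close> and approximate for the new
  mapping, which compactness turns into one that is exact for both.
\<close>

lemma finite_family_retraction:
  fixes C :: "('a::banach \<Rightarrow>\<^sub>L real) set"
  assumes C: "compactin weak_star_topology C" "convex C"
    and \<F>: "finite \<F>"
    and maps: "\<And>T. T \<in> \<F> \<Longrightarrow> T \<in> C \<rightarrow> C"
    and cont: "\<And>T. T \<in> \<F> \<Longrightarrow> weak_star_continuous_on C T"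
    and nonexp: "\<And>T. T \<in> \<F> \<Longrightarrow> nonexpansive_on C T"
    and comm: "\<And>T U x. T \<in> \<F> \<Longrightarrow> U \<in> \<F> \<Longrightarrow> x \<in> C \<Longrightarrow> T (U x) = U (T x)"
  shows "\<exists>R \<in> C \<rightarrow> common_Fix C \<F>. nonexpansive_on C R \<and> (\<forall>x\<in>common_Fix C \<F>. R x = x)"
  using \<F> maps cont nonexp comm
proof (induction \<F> rule: finite_induct)
  case empty
  have "(\<lambda>x. x) \<in> C \<rightarrow> common_Fix C {}" "nonexpansive_on C (\<lambda>x. x)"
    by (auto simp: mem_common_Fix nonexpansive_on_def)
  then show ?case by blast
next
  case (insert T \<F>)
  let ?D = "common_Fix C \<F>"
  have "\<exists>R \<in> C \<rightarrow> ?D. nonexpansive_on C R \<and> (\<forall>x\<in>?D. R x = x)"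
    by (rule insert.IH) (simp_all add: insert.prems)
  then obtain R where R: "R \<in> C \<rightarrow> ?D" "nonexpansive_on C R" "\<And>x. x \<in> ?D \<Longrightarrow> R x = x"
    by (elim bexE conjE) simp
  have D: "?D \<subseteq> C"
    by (auto simp: mem_common_Fix)
  have T: "T \<in> C \<rightarrow> C" "nonexpansive_on C T"
    using insert.prems by auto
  have "T x \<in> ?D" if "x \<in> ?D" for x
  proof -
    have "U (T x) = T x" if "U \<in> \<F>" for U
    proof -
      have "U x = x"
        using that \<open>x \<in> ?D\<close> by (simp add: mem_common_Fix)
      moreover have "U (T x) = T (U x)"
        using that \<open>x \<in> ?D\<close> by (intro insert.prems(4)) (auto simp: mem_common_Fix)
      ultimately show ?thesis by simp
    qed
    then show ?thesis
      using that T(1) by (auto simp: mem_common_Fix)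
  qed
  then have T_D: "T \<in> ?D \<rightarrow> ?D" by blast
  have approx: "\<exists>Q \<in> C \<rightarrow> C. nonexpansive_on C Q \<and> (\<forall>x\<in>common_Fix C (insert T \<F>). Q x = x) \<and>
          (\<forall>U\<in>\<G>. \<forall>x\<in>C. norm (U (Q x) - Q x) \<le> e)"
    if \<G>: "finite \<G>" "\<G> \<subseteq> insert T \<F>" and e: "0 < e" for \<G> and e :: real
  proof -
    obtain Q where Q: "Q \<in> C \<rightarrow> ?D" "nonexpansive_on C Q"
      "\<And>x. x \<in> ?D \<Longrightarrow> T x = x \<Longrightarrow> Q x = x" "\<And>x. x \<in> C \<Longrightarrow> norm (T (Q x) - Q x) \<le> e"
      using approximate_retraction_step[OF weak_star_compact_imp_complete[OF C(1)] C(2)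
          weak_star_compact_imp_bounded[OF C(1)] D R T_D T(2) e]
      by metis
    have "norm (U (Q x) - Q x) \<le> e" if "U \<in> \<G>" "x \<in> C" for U x
    proof (cases "U = T")
      case False
      then have "U (Q x) = Q x"
        using that \<G>(2) Q(1) by (auto simp: mem_common_Fix Pi_iff)
      then show ?thesis
        using e by simp
    qed (use Q(4) that in simp)
    moreover have "Q \<in> C \<rightarrow> C"
      using Q(1) by (auto simp: mem_common_Fix)
    moreover have "\<forall>x\<in>common_Fix C (insert T \<F>). Q x = x"
      using Q(3) by (auto simp: mem_common_Fix)
    ultimately show ?thesis
      using Q(2) by blast
  qed
  show ?case
    using insert.prems(2) approx by (rule retraction_from_approximate_retractions[OF C(1)])
qed

theorem theorem3p5:
  fixes C :: "('a::banach \<Rightarrow>\<^sub>L real) set"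
    and \<S> :: "(('a \<Rightarrow>\<^sub>L real) \<Rightarrow> ('a \<Rightarrow>\<^sub>L real)) set"
  assumes "C \<noteq> {}"
    and "compactin weak_star_topology C"
    and "convex C"
    and "\<And>T. T \<in> \<S> \<Longrightarrow> T \<in> C \<rightarrow> C"
    and "\<And>T. T \<in> \<S> \<Longrightarrow> weak_star_continuous_on C T"
    and "\<And>T. T \<in> \<S> \<Longrightarrow> nonexpansive_on C T"
    and "\<And>T U x. T \<in> \<S> \<Longrightarrow> U \<in> \<S> \<Longrightarrow> x \<in> C \<Longrightarrow> T (U x) = U (T x)"
  shows "nonexpansive_retract (common_Fix C \<S>) C"
proof -
  have approx: "\<exists>R \<in> C \<rightarrow> C. nonexpansive_on C R \<and> (\<forall>x\<in>common_Fix C \<S>. R x = x) \<and>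
          (\<forall>T\<in>\<F>. \<forall>x\<in>C. norm (T (R x) - R x) \<le> e)"
    if \<F>: "finite \<F>" "\<F> \<subseteq> \<S>" and e: "0 < e" for \<F> and e :: real
  proof -
    have "\<exists>R \<in> C \<rightarrow> common_Fix C \<F>. nonexpansive_on C R \<and> (\<forall>x\<in>common_Fix C \<F>. R x = x)"
      using \<F> assms(4-7) by (intro finite_family_retraction assms(2,3)) (auto simp: subset_iff)
    then obtain R where R: "R \<in> C \<rightarrow> common_Fix C \<F>" "nonexpansive_on C R"
      "\<And>x. x \<in> common_Fix C \<F> \<Longrightarrow> R x = x"
      by blast
    have "\<forall>T\<in>\<F>. \<forall>x\<in>C. norm (T (R x) - R x) \<le> e"
    proof (intro ballI)
      fix T x
      assume "T \<in> \<F>" "x \<in> C"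
      then have "T (R x) = R x"
        using R(1) by (auto simp: mem_common_Fix Pi_iff)
      then show "norm (T (R x) - R x) \<le> e"
        using e by simp
    qed
    moreover have "\<forall>x\<in>common_Fix C \<S>. R x = x"
    proof
      fix x
      assume "x \<in> common_Fix C \<S>"
      then have "x \<in> common_Fix C \<F>"
        using \<F>(2) by (auto simp: mem_common_Fix)
      then show "R x = x"
        by (rule R(3))
    qed
    moreover have "R \<in> C \<rightarrow> C"
      using R(1) by (auto simp: mem_common_Fix)
    ultimately show ?thesis
      using R(2) by blast
  qed
  have "\<exists>R \<in> C \<rightarrow> common_Fix C \<S>. nonexpansive_on C R \<and> (\<forall>x\<in>common_Fix C \<S>. R x = x)"
    using assms(5) approx by (rule retraction_from_approximate_retractions[OF assms(2)])
  then obtain R where R: "R \<in> C \<rightarrow> common_Fix C \<S>" "nonexpansive_on C R"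
    "\<forall>x\<in>common_Fix C \<S>. R x = x"
    by blast
  \<comment> \<open>Common fixed points exist because \<open>R\<close> maps the nonempty set \<open>C\<close> to them.\<close>
  moreover have "common_Fix C \<S> \<noteq> {}"
    using R(1) assms(1) by blast
  moreover have "common_Fix C \<S> \<subseteq> C"
    by (auto simp: mem_common_Fix)
  ultimately show ?thesis
    unfolding nonexpansive_retract_def by blast
qed

end
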